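(* Let $m$ and $r$ be positive integers with $2 \le m \le r-1$. Let $G$ be an $r$-regular graph of even order with $\lambda_{oc}(G) \ge (2m-1)(r-1)$, and let $M$ be a matching in $G$ with $|M| = m$. If there exist $mr-r+1$ edge-disjoint odd ears of $V(M)$ in $G$, then $M$ extends to a perfect matching of $G$.
   Context: All graphs are finite and simple. $V(M)$ is the set of endvertices of the edges of $M$. A set $F$ of edges of a graph $G$ is a cyclic edge cut if $G-F$ has two components each of which contains a cycle. $F$ is an odd-cyclic edge cut if $F$ is a cyclic edge cut such that a component of $G-F$ contains a cycle of odd length. $\lambda_{oc}(G)$ denotes the size of a minimum odd-cyclic edge cut of $G$; if $G$ has no odd-cyclic edge cut, $\lambda_{oc}(G)=\infty$. For $U \subseteq V(G)$, an ear of $U$ is either a path having both endvertices but no internal vertices in $U$, or a cycle having exactly one vertex in $U$ (in particular, every edge joining two vertices of $U$ is an ear of $U$). An ear is odd if it contains an odd number of edges. A matching $M$ of $G$ extends to a perfect matching if there is a perfect matching $M^*$ of $G$ with $M \subseteq M^*$. *)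

theory Defs
  imports "HOL-Library.Extended_Nat" "HOL-Library.Disjoint_Sets"
begin

definition simple_graph :: "'a set \<Rightarrow> 'a set set \<Rightarrow> bool" where
  "simple_graph V E \<longleftrightarrow> finite V \<and> (\<forall>e\<in>E. e \<subseteq> V \<and> card e = 2)"

definition degree :: "'a set set \<Rightarrow> 'a \<Rightarrow> nat" where
  "degree E v = card {e \<in> E. v \<in> e}"

definition regular :: "nat \<Rightarrow> 'a set \<Rightarrow> 'a set set \<Rightarrow> bool" where
  "regular r V E \<longleftrightarrow> (\<forall>v\<in>V. degree E v = r)"

(* For a matching M, the vertex set V(M) is the union of its edges. *)
definition matching :: "'a set set \<Rightarrow> 'a set set \<Rightarrow> bool" where
  "matching E M \<longleftrightarrow> M \<subseteq> E \<and> disjoint M"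

definition perfect_matching :: "'a set \<Rightarrow> 'a set set \<Rightarrow> 'a set set \<Rightarrow> bool" where
  "perfect_matching V E M \<longleftrightarrow> matching E M \<and> \<Union>M = V"

definition path_edges :: "'a list \<Rightarrow> 'a set set" where
  "path_edges p = {{p ! i, p ! Suc i} | i. Suc i < length p}"

(* The list of vertices of a path in order; a single vertex is a path without edges. *)
definition is_path :: "'a set \<Rightarrow> 'a set set \<Rightarrow> 'a list \<Rightarrow> bool" where
  "is_path V E p \<longleftrightarrow> p \<noteq> [] \<and> distinct p \<and> set p \<subseteq> V \<and> path_edges p \<subseteq> E"

definition cycle_edges :: "'a list \<Rightarrow> 'a set set" where
  "cycle_edges c = insert {last c, hd c} (path_edges c)"

(* The vertices of a cycle in cyclic order, the first one not being repeated at the end. *)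
definition is_cycle :: "'a set \<Rightarrow> 'a set set \<Rightarrow> 'a list \<Rightarrow> bool" where
  "is_cycle V E c \<longleftrightarrow> 3 \<le> length c \<and> distinct c \<and> set c \<subseteq> V \<and> cycle_edges c \<subseteq> E"

(* Components are represented by their vertex sets. *)
definition components :: "'a set \<Rightarrow> 'a set set \<Rightarrow> 'a set set" where
  "components V E = V // {(x, y). {x, y} \<in> E}\<^sup>*"

definition cyclic_edge_cut :: "'a set \<Rightarrow> 'a set set \<Rightarrow> 'a set set \<Rightarrow> bool" where
  "cyclic_edge_cut V E F \<longleftrightarrow> F \<subseteq> E \<and>
     (\<exists>C\<in>components V (E - F). \<exists>D\<in>components V (E - F). C \<noteq> D \<and>
        (\<exists>c. is_cycle C (E - F) c) \<and> (\<exists>d. is_cycle D (E - F) d))"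

definition odd_cyclic_edge_cut :: "'a set \<Rightarrow> 'a set set \<Rightarrow> 'a set set \<Rightarrow> bool" where
  "odd_cyclic_edge_cut V E F \<longleftrightarrow> cyclic_edge_cut V E F \<and>
     (\<exists>C\<in>components V (E - F). \<exists>c. is_cycle C (E - F) c \<and> odd (card (cycle_edges c)))"

(* The infimum of the empty set is \<infinity> in enat. *)
definition lambda_oc :: "'a set \<Rightarrow> 'a set set \<Rightarrow> enat" where
  "lambda_oc V E = (INF F\<in>{F. odd_cyclic_edge_cut V E F}. enat (card F))"

(* Ears are represented by their edge sets. *)
definition is_ear :: "'a set \<Rightarrow> 'a set set \<Rightarrow> 'a set \<Rightarrow> 'a set set \<Rightarrow> bool" where
  "is_ear V E U P \<longleftrightarrow>
     (\<exists>p. is_path V E p \<and> hd p \<in> U \<and> last p \<in> U \<and> (set p - {hd p, last p}) \<inter> U = {} \<and>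
          P = path_edges p) \<or>
     (\<exists>c. is_cycle V E c \<and> (\<exists>u. set c \<inter> U = {u}) \<and> P = cycle_edges c)"

definition odd_ear :: "'a set \<Rightarrow> 'a set set \<Rightarrow> 'a set \<Rightarrow> 'a set set \<Rightarrow> bool" where
  "odd_ear V E U P \<longleftrightarrow> is_ear V E U P \<and> odd (card P)"

(* Odd ears have a nonempty edge set, so edge-disjoint odd ears are distinct elements of a set. *)
definition has_disjoint_odd_ears :: "'a set \<Rightarrow> 'a set set \<Rightarrow> 'a set \<Rightarrow> nat \<Rightarrow> bool" where
  "has_disjoint_odd_ears V E U k \<longleftrightarrow>
     (\<exists>\<P>. finite \<P> \<and> card \<P> = k \<and> (\<forall>P\<in>\<P>. odd_ear V E U P) \<and> disjoint \<P>)"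

end

theory Submission imports Defs
begin

text \<open>If \<open>M\<close> does not extend, the Tutte-Berge theorem gives \<open>S \<subseteq> V - V(M)\<close> such that
  \<open>G - V(M) - S\<close> has at least \<open>|S| + 2\<close> odd components. Each of them sends out at least \<open>r\<close>
  edges, and any part containing an odd cycle sends out at least \<open>(2m-1)(r-1)\<close>. But \<open>S\<close> and
  \<open>V(M)\<close> receive at most \<open>r|S| + 2m(r-1)\<close> edges in total, so every part is bipartite. The larger
  colour classes form an independent set \<open>W\<close> with \<open>2|W| \<ge> |V| - 2m + 2\<close>, and counting
  degrees shows that at most \<open>mr - r\<close> edges avoid \<open>W\<close>. An ear of \<open>V(M)\<close> all of whose edges meet
  \<open>W\<close> alternates between \<open>W\<close> and its complement, hence is even. So every odd ear contains one
  of those at most \<open>mr - r\<close> edges.\<close>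

section \<open>Paths and cycles\<close>

lemma path_edges_simps [simp]:
  "path_edges [] = {}" "path_edges [x] = {}"
  "path_edges (x # y # p) = insert {x, y} (path_edges (y # p))"
proof -
  show "path_edges (x # y # p) = insert {x, y} (path_edges (y # p))"
    unfolding path_edges_def
  proof (intro equalityI subsetI)
    fix e assume "e \<in> {{(x # y # p) ! i, (x # y # p) ! Suc i} |i. Suc i < length (x # y # p)}"
    then obtain i where "e = {(x # y # p) ! i, (x # y # p) ! Suc i}" "Suc i < length (x # y # p)"
      by blast
    then show "e \<in> insert {x, y} {{(y # p) ! i, (y # p) ! Suc i} |i. Suc i < length (y # p)}"
      by (cases i) auto
  next
    fix e assume "e \<in> insert {x, y} {{(y # p) ! i, (y # p) ! Suc i} |i. Suc i < length (y # p)}"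
    then consider "e = {x, y}"
      | i where "e = {(y # p) ! i, (y # p) ! Suc i}" "Suc i < length (y # p)"
      by blast
    then show "e \<in> {{(x # y # p) ! i, (x # y # p) ! Suc i} |i. Suc i < length (x # y # p)}"
    proof cases
      case 1
      then show ?thesis by (auto intro: exI [of _ 0])
    next
      case (2 i)
      then show ?thesis by (auto intro: exI [of _ "Suc i"])
    qed
  qed
qed (simp_all add: path_edges_def)

lemma path_edges_subset: "e \<in> path_edges p \<Longrightarrow> e \<subseteq> set p"
  by (auto simp: path_edges_def)

lemma finite_path_edges [simp]: "finite (path_edges p)"
  by (induction p rule: induct_list012) auto

lemma card_path_edges: "distinct p \<Longrightarrow> card (path_edges p) = length p - 1"
proof (induction p rule: induct_list012)
  case (3 x y p)
  have "{x, y} \<notin> path_edges (y # p)"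
    using 3(3) path_edges_subset by fastforce
  with 3 show ?case by simp
qed auto

lemma card_cycle_edges:
  assumes "distinct c" "3 \<le> length c"
  shows "card (cycle_edges c) = length c"
proof -
  obtain x y q where c: "c = x # y # q" "q \<noteq> []"
    using assms(2) by (cases c rule: remdups_adj.cases) force+
  then have last: "last c \<in> set q" by simp
  have "{last c, x} \<notin> path_edges (y # q)"
    using assms(1) path_edges_subset [of "{last c, x}" "y # q"] by (auto simp: c(1))
  moreover have "{last c, x} \<noteq> {x, y}"
    using assms(1) last by (auto simp: c(1) doubleton_eq_iff)
  ultimately have "{last c, hd c} \<notin> path_edges c"
    by (simp add: c(1))
  then show ?thesis
    using assms(2) by (simp add: cycle_edges_def card_path_edges [OF assms(1)])
qed

text \<open>Each edge switches membership in \<open>A\<close>, so the two ends agree exactly when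
  the number of edges, \<open>length p - 1\<close>, is even. This parity serves both for odd cycles
  and for odd ears.\<close>

lemma path_edges_alternating:
  assumes "p \<noteq> []" and "\<And>x y. {x, y} \<in> path_edges p \<Longrightarrow> x \<in> A \<longleftrightarrow> y \<notin> A"
  shows "(hd p \<in> A \<longleftrightarrow> last p \<in> A) \<longleftrightarrow> odd (length p)"
  using assms
proof (induction p rule: induct_list012)
  case (3 x y p)
  have "x \<in> A \<longleftrightarrow> y \<notin> A" using 3(4) by simp
  moreover have "(hd (y # p) \<in> A \<longleftrightarrow> last (y # p) \<in> A) \<longleftrightarrow> odd (length (y # p))"
    using 3 by (intro "3.IH"(2)) auto
  ultimately show ?case by auto
qed auto

text \<open>The walk is shortened while it grows: a new first vertex that already lies on the path
  cuts it back to the suffix starting there, which keeps the list distinct.\<close>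

lemma connected_obtains_path:
  assumes "(x, y) \<in> {(x, y). {x, y} \<in> E}\<^sup>*"
  obtains p where "p \<noteq> []" "distinct p" "hd p = x" "last p = y" "path_edges p \<subseteq> E"
proof -
  from assms have "\<exists>p. p \<noteq> [] \<and> distinct p \<and> hd p = x \<and> last p = y \<and> path_edges p \<subseteq> E"
  proof (induction rule: converse_rtrancl_induct)
    case base
    show ?case by (rule exI [of _ "[y]"]) simp
  next
    case (step x z)
    then obtain p where p: "p \<noteq> []" "distinct p" "hd p = z" "last p = y" "path_edges p \<subseteq> E"
      by blast
    show ?case
    proof (cases "x \<in> set p")
      case False
      obtain p' where "p = z # p'" using p(1,3) by (cases p) auto
      then show ?thesis
        using p step(1) False by (intro exI [of _ "x # p"]) auto
    next
      case True
      then obtain q p' where q: "p = q @ x # p'" by (meson split_list)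
      have "path_edges (x # p') \<subseteq> path_edges (q @ x # p')"
        by (induction q rule: induct_list012) (cases p', auto)
      then show ?thesis
        using p q by (intro exI [of _ "x # p'"]) auto
    qed
  qed
  with that show ?thesis by blast
qed

text \<open>Since \<open>{x, y}\<close> is not in \<open>E\<close>, the path has an inner vertex, so
  closing it up involves at least three vertices.\<close>

lemma closing_edge_cycle:
  assumes E: "\<And>e. e \<in> E \<Longrightarrow> e \<subseteq> V" and "x \<noteq> y" "{x, y} \<notin> E" "{x, y} \<subseteq> V"
    and p: "p \<noteq> []" "distinct p" "hd p = x" "last p = y" "path_edges p \<subseteq> E"
  shows "is_cycle V (insert {x, y} E) p"
proof -
  obtain z q where q: "p = x # z # q"
    using p \<open>x \<noteq> y\<close> by (metis hd_Cons_tl last_ConsL)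
  have "q \<noteq> []" using p q \<open>{x, y} \<notin> E\<close> by auto
  then have "3 \<le> length p" using q by (cases q) auto
  moreover have "set p \<subseteq> insert (last p) (\<Union>(path_edges p))"
    by (induction p rule: induct_list012) auto
  then have "set p \<subseteq> V"
    using p E \<open>{x, y} \<subseteq> V\<close> by blast
  ultimately show ?thesis
    using p by (auto simp: is_cycle_def cycle_edges_def insert_commute)
qed

section \<open>Edge counts of forests, and odd cycles in non-bipartite graphs\<close>

lemma is_cycle_mono: "is_cycle V E c \<Longrightarrow> E \<subseteq> E' \<Longrightarrow> is_cycle V E' c"
  by (auto simp: is_cycle_def)

text \<open>Translates the encoding of a crossing edge by a cardinality into a statement on its
  ends; \<open>Suc 0\<close> is the form into which the simplifier turns \<open>1\<close>.\<close>

lemma card_doubleton_Int: "x \<noteq> y \<Longrightarrow> card ({x, y} \<inter> A) = Suc 0 \<longleftrightarrow> (x \<in> A \<longleftrightarrow> y \<notin> A)"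
  by (cases "x \<in> A"; cases "y \<in> A") auto

lemma card_2_obtains:
  assumes "card e = 2" "x \<in> e"
  obtains y where "x \<noteq> y" "e = {x, y}"
proof -
  obtain a b where "e = {a, b}" "a \<noteq> b" using assms(1) by (auto simp: card_2_iff)
  then show ?thesis using assms(2) that [of a] that [of b] by (auto simp: insert_commute)
qed

text \<open>The function \<open>f\<close> in the proof labels the connected components.\<close>

lemma acyclic_card_edges:
  assumes "finite E" "finite V" "V \<noteq> {}" "\<And>e. e \<in> E \<Longrightarrow> e \<subseteq> V \<and> card e = 2"
    and "\<nexists>c. is_cycle V E c"
  shows "card E + 1 \<le> card V"
proof -
  \<comment> \<open>Invariant while edges are added: each new edge merges two labels, so labels and
    edges together always number \<open>card V\<close>. Equal labels mean connected, so an edge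
    between equally labelled vertices would close a cycle.\<close>
  have "\<exists>f :: 'a \<Rightarrow> 'a. card (f ` V) + card E = card V \<and>
      (\<forall>x y. f x = f y \<longrightarrow> (x, y) \<in> {(x, y). {x, y} \<in> E}\<^sup>*)"
    using assms(1,4,5)
  proof (induction E rule: finite_induct)
    case empty
    show ?case by (intro exI [of _ id]) auto
  next
    case (insert e E)
    have "\<nexists>c. is_cycle V E c" using insert.prems(2) is_cycle_mono by (metis subset_insertI)
    then obtain f :: "'a \<Rightarrow> 'a" where f: "card (f ` V) + card E = card V"
        "\<And>x y. f x = f y \<Longrightarrow> (x, y) \<in> {(x, y). {x, y} \<in> E}\<^sup>*"
      using insert by auto
    obtain x y where e: "e = {x, y}" "x \<noteq> y" "x \<in> V" "y \<in> V"
      using insert.prems(1) [of e] by (auto simp: card_2_iff)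
    have ne: "f x \<noteq> f y"
    proof
      assume "f x = f y"
      then obtain p where "p \<noteq> []" "distinct p" "hd p = x" "last p = y" "path_edges p \<subseteq> E"
        using connected_obtains_path f(2) by metis
      then have "is_cycle V (insert {x, y} E) p"
        using insert e by (intro closing_edge_cycle) auto
      then show False using insert.prems(2) e by auto
    qed
    let ?R = "{(x, y). {x, y} \<in> insert e E}\<^sup>*"
    \<comment> \<open>The label of \<open>x\<close> is merged into that of \<open>y\<close>, so
      exactly \<open>f x\<close> disappears from the image.\<close>
    define g where "g v = (if f v = f x then f y else f v)" for v
    have "g ` V = f ` V - {f x}" using ne e by (auto simp: g_def)
    moreover have "card (f ` V) > 0" using e assms(2) by (auto simp: card_gt_0_iff)
    ultimately have "card (g ` V) + card (insert e E) = card V"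
      using insert e f(1) assms(2) by simp
    moreover have "(u, v) \<in> ?R" if "g u = g v" for u v
    proof -
      have sub: "(a, b) \<in> ?R" if "f a = f b" for a b
        using f(2) [OF that] rtrancl_mono [of "{(x, y). {x, y} \<in> E}" "{(x, y). {x, y} \<in> insert e E}"]
        by auto
      have xy: "(x, y) \<in> ?R" "(y, x) \<in> ?R" using e by (auto simp: insert_commute)
      consider "f u = f v" | "f u = f x" "f y = f v" | "f u = f y" "f x = f v"
        using \<open>g u = g v\<close> by (auto simp: g_def split: if_splits)
      then show ?thesis
        using sub xy by cases (meson rtrancl_trans)+
    qed
    ultimately show ?case by blast
  qed
  then obtain f :: "'a \<Rightarrow> 'a" where "card (f ` V) + card E = card V" by blast
  \<comment> \<open>At least one label remains, which accounts for the \<open>+ 1\<close>.\<close>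
  moreover have "card (f ` V) > 0" using assms(2,3) by (simp add: card_gt_0_iff)
  ultimately show ?thesis by linarith
qed

text \<open>Edges are added one at a time to a 2-coloured graph. Trouble arises only if both ends of
  the new edge have the same colour: if they are already connected, an alternating path between them
  closes to an odd cycle; otherwise one component can be recoloured.\<close>

lemma bipartite_or_odd_cycle:
  assumes "finite E" "\<And>e. e \<in> E \<Longrightarrow> e \<subseteq> V \<and> card e = 2"
  shows "(\<exists>A. \<forall>e\<in>E. card (e \<inter> A) = 1) \<or> (\<exists>c. is_cycle V E c \<and> odd (card (cycle_edges c)))"
  using assms
proof (induction E rule: finite_induct)
  case (insert e E)
  obtain x y where e: "e = {x, y}" "x \<noteq> y" "x \<in> V" "y \<in> V"
    using insert.prems(1) [of e] by (auto simp: card_2_iff)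
  show ?case
  proof (cases "\<exists>c. is_cycle V E c \<and> odd (card (cycle_edges c))")
    case True
    then show ?thesis using is_cycle_mono by (metis subset_insertI)
  next
    case False
    then obtain A where A: "\<And>e. e \<in> E \<Longrightarrow> card (e \<inter> A) = 1"
      using insert by blast
    let ?R = "{(x, y). {x, y} \<in> E}\<^sup>*"
    consider "x \<in> A \<longleftrightarrow> y \<notin> A" | "x \<in> A \<longleftrightarrow> y \<in> A" "(x, y) \<in> ?R" | "x \<in> A \<longleftrightarrow> y \<in> A" "(x, y) \<notin> ?R"
      by blast
    then show ?thesis
    proof cases
      case 1
      then have "card (e \<inter> A) = 1" using e by (simp add: card_doubleton_Int)
      then show ?thesis using A by blast
    next
      case 2
      then obtain p where p: "p \<noteq> []" "distinct p" "hd p = x" "last p = y" "path_edges p \<subseteq> E"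
        using connected_obtains_path by metis
      then have cyc: "is_cycle V (insert e E) p"
        using insert e by (auto intro!: closing_edge_cycle)
      have "u \<in> A \<longleftrightarrow> v \<notin> A" if "{u, v} \<in> path_edges p" for u v
        using that p A insert.prems [of "{u, v}"] card_doubleton_Int [of u v A]
        by (cases "u = v") auto
      then have "odd (length p)"
        using path_edges_alternating [of p A] p 2 by auto
      then have "odd (card (cycle_edges p))"
        using cyc card_cycle_edges [of p] by (simp add: is_cycle_def)
      then show ?thesis using cyc by blast
    next
      case 3
      \<comment> \<open>Swapping colours throughout the component \<open>C\<close> of
        \<open>x\<close>, that is, passing to the symmetric difference of \<open>A\<close> and
        \<open>C\<close>, keeps the old edges crossing and separates \<open>x\<close> from
        \<open>y\<close>.\<close>
      define C where "C = ?R `` {x}"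
      have "card (f \<inter> ((A - C) \<union> (C - A))) = 1" if "f \<in> insert e E" for f
      proof (cases "f = e")
        case True
        have "x \<in> C" "y \<notin> C" using 3 by (auto simp: C_def)
        then show ?thesis using True e 3 by (auto simp: card_doubleton_Int)
      next
        case False
        then have f: "f \<in> E" using that by simp
        then obtain u v where uv: "f = {u, v}" "u \<noteq> v"
          using insert.prems [of f] by (auto simp: card_2_iff)
        have "(u, v) \<in> ?R" "(v, u) \<in> ?R" using f uv by (auto simp: insert_commute)
        then have "u \<in> C \<longleftrightarrow> v \<in> C"
          by (auto simp: C_def intro: rtrancl_trans)
        then show ?thesis
          using A [OF f] uv by (auto simp: card_doubleton_Int)
      qed
      then show ?thesis by blast
    qed
  qed
qed auto

section \<open>The Tutte-Berge theorem\<close>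

definition maximum_matching :: "'a set set \<Rightarrow> 'a set set \<Rightarrow> bool" where
  "maximum_matching E M \<longleftrightarrow> matching E M \<and> (\<forall>N. matching E N \<longrightarrow> card N \<le> card M)"

lemma simple_graph_finite: "simple_graph V E \<Longrightarrow> finite E"
  by (rule finite_subset [of _ "Pow V"]) (auto simp: simple_graph_def)

lemma matching_finite: "simple_graph V E \<Longrightarrow> matching E M \<Longrightarrow> finite M"
  by (auto simp: matching_def dest: simple_graph_finite intro: finite_subset)

lemma matching_finite_Union: "simple_graph V E \<Longrightarrow> matching E M \<Longrightarrow> finite (\<Union>M)"
  by (rule finite_subset [of _ V]) (auto simp: simple_graph_def matching_def)

lemma card_Union_matching:
  assumes "simple_graph V E" "matching E M"
  shows "card (\<Union>M) = 2 * card M"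
proof -
  have M: "e \<in> M \<Longrightarrow> finite e \<and> card e = 2" for e
    using assms by (auto simp: simple_graph_def matching_def intro: finite_subset)
  then have "card (\<Union>M) = (\<Sum>e\<in>M. card e)"
    using assms(2) by (intro card_Union_disjoint) (auto simp: matching_def disjoint_def pairwise_def disjnt_def)
  then show ?thesis using M by simp
qed

lemma ex_maximum_matching:
  assumes "simple_graph V E"
  obtains M where "maximum_matching E M"
proof -
  have "{M. matching E M} \<subseteq> Pow E" by (auto simp: matching_def)
  then have fin: "finite {M. matching E M}"
    using simple_graph_finite [OF assms] by (auto intro: finite_subset)
  have "matching E {}" by (simp add: matching_def)
  then have ne: "{M. matching E M} \<noteq> {}" by blast
  obtain M where "M \<in> {M. matching E M}" "card M = Max (card ` {M. matching E M})"
    using Max_in [of "card ` {M. matching E M}"] fin ne by (auto simp: image_iff)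
  then have "maximum_matching E M"
    using fin by (auto simp: maximum_matching_def)
  with that show ?thesis .
qed

lemma matching_insert:
  assumes "matching E M" "e \<in> E" "e \<inter> \<Union>M = {}"
  shows "matching E (insert e M)"
  using assms by (auto simp: matching_def disjoint_def)

lemma maximum_matching_meets_edge:
  assumes "simple_graph V E" "maximum_matching E M" "e \<in> E"
  shows "e \<inter> \<Union>M \<noteq> {}"
proof
  assume *: "e \<inter> \<Union>M = {}"
  have "e \<noteq> {}" using assms by (auto simp: simple_graph_def)
  then have "e \<notin> M" using * by blast
  moreover have "finite M"
    using assms matching_finite by (auto simp: maximum_matching_def)
  moreover have "matching E (insert e M)"
    using assms * by (intro matching_insert) (auto simp: maximum_matching_def)
  ultimately show False using assms(2) unfolding maximum_matching_def by fastforce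
qed

text \<open>Gallai's lemma. Exchanging an edge of \<open>N\<close> for an edge of \<open>M\<close> at a vertex
  missed by \<open>N\<close> would increase \<open>card (M \<inter> N)\<close>.\<close>

lemma gallai_exchange:
  assumes G: "simple_graph V E" and M: "maximum_matching E M"
    and uv: "u \<noteq> v" "u \<notin> \<Union>M" "v \<notin> \<Union>M"
    and ex: "maximum_matching E N0" "t \<notin> \<Union>N0"
  shows "\<exists>N. maximum_matching E N \<and> t \<notin> \<Union>N \<and> (u \<notin> \<Union>N \<or> v \<notin> \<Union>N)"
proof (rule ccontr)
  assume "\<not> ?thesis"
  then have cover: "\<And>N. maximum_matching E N \<Longrightarrow> t \<notin> \<Union>N \<Longrightarrow> u \<in> \<Union>N \<and> v \<in> \<Union>N" by blast
  have mM: "matching E M" and fM: "finite M" and finM: "finite (\<Union>M)"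
    using M matching_finite [OF G] matching_finite_Union [OF G] by (auto simp: maximum_matching_def)
  define P where "P N \<longleftrightarrow> maximum_matching E N \<and> t \<notin> \<Union>N" for N
  have "P N0" using ex by (simp add: P_def)
  moreover have "\<forall>N. P N \<longrightarrow> card (M \<inter> N) < Suc (card M)"
    using fM by (simp add: card_mono less_Suc_eq_le)
  \<comment> \<open>Among the maximum matchings missing \<open>t\<close>, \<open>N\<close> shares
    the most edges with \<open>M\<close>.\<close>
  ultimately obtain N where N: "P N" "\<And>N'. P N' \<Longrightarrow> card (M \<inter> N') \<le> card (M \<inter> N)"
    using ex_has_greatest_nat [of P N0 "\<lambda>N. card (M \<inter> N)"] by blast
  have mN: "matching E N" and tN: "t \<notin> \<Union>N" and maxN: "maximum_matching E N"
    using N(1) by (auto simp: P_def maximum_matching_def)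
  have fN: "finite N" using mN G matching_finite by blast
  have finN: "finite (\<Union>N)"
    using mN G by (intro matching_finite_Union)
  have "card M = card N"
    using M maxN by (auto simp: maximum_matching_def intro: antisym)
  then have "card (\<Union>M) = card (\<Union>N)"
    using card_Union_matching [OF G] mM mN by simp
  \<comment> \<open>\<open>N\<close> covers \<open>u\<close> and \<open>v\<close>, which
    \<open>M\<close> misses. As both matchings cover equally many vertices, \<open>M\<close> covers
    at least two vertices missed by \<open>N\<close>, and one of them differs from
    \<open>t\<close>.\<close>
  then have "card (\<Union>M - \<Union>N) = card (\<Union>N - \<Union>M)"
    using card_Int_Diff [OF finM, of "\<Union>N"] card_Int_Diff [OF finN, of "\<Union>M"]
    by (simp add: Int_commute)
  moreover have "card {u, v} \<le> card (\<Union>N - \<Union>M)"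
    using cover [OF maxN tN] uv finN by (intro card_mono) auto
  ultimately have "\<not> \<Union>M - \<Union>N \<subseteq> {t}"
    using uv(1) card_mono [of "{t}" "\<Union>M - \<Union>N"] by auto
  then obtain x e where x: "x \<noteq> t" "x \<notin> \<Union>N" "x \<in> e" "e \<in> M" by blast
  have eE: "e \<in> E" "card e = 2" using x mM G by (auto simp: matching_def simple_graph_def)
  obtain y where y: "x \<noteq> y" "e = {x, y}" using card_2_obtains eE x by metis
  have "y \<in> \<Union>N"
    using maximum_matching_meets_edge [OF G maxN eE(1)] y x by auto
  then obtain f where f: "f \<in> N" "y \<in> f" by blast
  \<comment> \<open>The exchange at \<open>y\<close>: since \<open>x\<close> differs from
    \<open>t\<close> and \<open>y\<close> is covered by \<open>N\<close>, the new matching still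
    misses \<open>t\<close>, but it shares one more edge with \<open>M\<close>.\<close>
  define N' where "N' = insert e (N - {f})"
  have "e \<notin> N" using x by auto
  have "f \<notin> M"
  proof
    assume "f \<in> M"
    moreover have "f \<noteq> e" using x f by blast
    ultimately have "f \<inter> e = {}" using mM x(4) by (simp add: matching_def disjoint_def)
    then show False using y f by blast
  qed
  have "y \<notin> \<Union>(N - {f})"
    using mN f by (auto simp: matching_def disjoint_def)
  then have "matching E N'" unfolding N'_def
    using mN x y eE by (intro matching_insert) (auto simp: matching_def disjoint_def)
  moreover have "card N' = card N"
    using \<open>e \<notin> N\<close> card_Suc_Diff1 [OF fN f(1)] fN
    by (simp add: N'_def del: card_Diff_singleton)
  ultimately have "maximum_matching E N'"
    using maxN unfolding maximum_matching_def by metis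
  moreover have "t \<notin> \<Union>N'"
    using x y tN \<open>y \<in> \<Union>N\<close> by (auto simp: N'_def)
  ultimately have "card (M \<inter> N') \<le> card (M \<inter> N)" using N(2) by (simp add: P_def)
  moreover have "M \<inter> N' = insert e (M \<inter> N)"
    using x \<open>f \<notin> M\<close> unfolding N'_def by blast
  then have "card (M \<inter> N') = Suc (card (M \<inter> N))"
    using card_insert_disjoint [of "M \<inter> N" e] \<open>e \<notin> N\<close> fM by auto
  ultimately show False by simp
qed

section \<open>Odd barriers and the deficiency formula\<close>

text \<open>Each member of \<open>\<Q>\<close> is a union of components of the graph without
  \<open>S\<close>, of odd total order, because no edge avoiding \<open>S\<close> leaves it. Closure
  under edges replaces any talk of components; members may be disconnected.\<close>

definition odd_barrier :: "'a set \<Rightarrow> 'a set set \<Rightarrow> 'a set \<Rightarrow> 'a set set \<Rightarrow> bool" where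
  "odd_barrier V E S \<Q> \<longleftrightarrow> S \<subseteq> V \<and> disjoint \<Q> \<and>
     (\<forall>Q\<in>\<Q>. Q \<subseteq> V - S \<and> odd (card Q) \<and> (\<forall>e\<in>E. e \<subseteq> Q \<or> e \<inter> Q = {} \<or> e \<inter> S \<noteq> {}))"

text \<open>By Gallai's lemma, not being missed simultaneously by a maximum matching is transitive.
  Its classes are the odd components.\<close>

lemma tutte_berge_missable:
  assumes G: "simple_graph V E" and M: "maximum_matching E M"
    and ex: "\<And>v. v \<in> V \<Longrightarrow> \<exists>N. maximum_matching E N \<and> v \<notin> \<Union>N"
  shows "\<exists>\<Q>. odd_barrier V E {} \<Q> \<and> card V \<le> card \<Q> + 2 * card M"
proof -
  have finV: "finite V" using G by (simp add: simple_graph_def)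
  define R where "R = {(u, v). u \<in> V \<and> v \<in> V \<and>
    (u = v \<or> (\<forall>N. maximum_matching E N \<longrightarrow> u \<in> \<Union>N \<or> v \<in> \<Union>N))}"
  have "trans R"
  proof (rule transI)
    fix u t v assume uv: "(u, t) \<in> R" "(t, v) \<in> R"
    show "(u, v) \<in> R"
    proof (rule ccontr)
      assume "(u, v) \<notin> R"
      then obtain N where N: "maximum_matching E N" "u \<noteq> v" "u \<notin> \<Union>N" "v \<notin> \<Union>N"
        using uv by (auto simp: R_def)
      obtain N0 where "maximum_matching E N0" "t \<notin> \<Union>N0"
        using ex [of t] uv unfolding R_def by blast
      then obtain K where "maximum_matching E K" "t \<notin> \<Union>K" "u \<notin> \<Union>K \<or> v \<notin> \<Union>K"
        using gallai_exchange [OF G N] by blast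
      then show False
        using uv N by (auto simp: R_def)
    qed
  qed
  then have eqv: "equiv V R"
    by (auto intro!: equivI refl_onI symI simp: R_def)
  have edge: "(x, y) \<in> R" if e: "e \<in> E" "x \<in> e" "y \<in> e" for e x y
  proof -
    have "card e = 2" "e \<subseteq> V" using e G by (auto simp: simple_graph_def)
    then obtain z where "e = {x, z}" using card_2_obtains e by metis
    then show ?thesis
      using maximum_matching_meets_edge [OF G _ \<open>e \<in> E\<close>] e \<open>e \<subseteq> V\<close> by (auto simp: R_def)
  qed
  have closed: "e \<subseteq> Q \<or> e \<inter> Q = {}" if "Q \<in> V // R" "e \<in> E" for Q e
    using that edge [OF that(2)] in_quotient_imp_closed [OF eqv that(1)] by blast
  \<comment> \<open>A maximum matching missing \<open>v\<close> covers every other vertex of its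
    class \<open>Q\<close>. As no edge leaves \<open>Q\<close>, it matches \<open>Q - {v}\<close>
    within \<open>Q\<close>.\<close>
  have "odd (card Q)" if Q: "Q \<in> V // R" for Q
  proof -
    obtain v where v: "v \<in> V" "Q = R `` {v}" using Q by (auto elim: quotientE)
    obtain N where N: "maximum_matching E N" "v \<notin> \<Union>N" using ex v by blast
    have mN: "matching E N" using N by (simp add: maximum_matching_def)
    let ?N = "{e \<in> N. e \<subseteq> Q}"
    have "Q \<subseteq> V" using v by (auto simp: R_def)
    then have "finite Q" using finV finite_subset by blast
    have "Q - {v} \<subseteq> \<Union>N" using v N by (auto simp: R_def)
    moreover have "e \<subseteq> Q \<or> e \<inter> Q = {}" if "e \<in> N" for e
      using closed [OF Q] mN that by (auto simp: matching_def)
    ultimately have "Q - {v} = \<Union>?N" using N(2) by blast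
    moreover have "matching E ?N" using mN by (auto simp: matching_def disjoint_def)
    ultimately have "card (Q - {v}) = 2 * card ?N"
      using card_Union_matching [OF G] by simp
    moreover have "v \<in> Q" using v by (simp add: R_def)
    ultimately show ?thesis
      using \<open>finite Q\<close> by (metis card_Suc_Diff1 dvd_triv_left even_Suc)
  qed
  moreover have "Q \<subseteq> V" if "Q \<in> V // R" for Q
    using that eqv by (simp add: in_quotient_imp_subset)
  moreover have "disjoint (V // R)"
    using quotient_disj [OF eqv] by (auto simp: disjoint_def)
  ultimately have "odd_barrier V E {} (V // R)"
    using closed by (auto simp: odd_barrier_def)
  moreover have "card V \<le> card (V // R) + 2 * card M"
  proof -
    have mM: "matching E M" using M by (simp add: maximum_matching_def)
    have "\<Union>M \<subseteq> V" using mM G by (auto simp: matching_def simple_graph_def)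
    then have "card V = card (V - \<Union>M) + 2 * card M"
      using card_Union_matching [OF G mM] finV
      by (metis card_Diff_subset card_mono finite_subset le_add_diff_inverse2)
    \<comment> \<open>Two vertices missed by \<open>M\<close> lie in different classes, so there are
      at least as many classes as missed vertices.\<close>
    moreover have "inj_on (\<lambda>v. R `` {v}) (V - \<Union>M)"
    proof (rule inj_onI)
      fix x y assume xy: "x \<in> V - \<Union>M" "y \<in> V - \<Union>M" "R `` {x} = R `` {y}"
      then have "(x, y) \<in> R" using eqv by (simp add: eq_equiv_class_iff)
      then show "x = y" using xy M by (auto simp: R_def)
    qed
    then have "card (V - \<Union>M) \<le> card (V // R)"
      using finite_quotient [OF finV equiv_type [OF eqv]]
      by (intro card_inj_on_le) (auto intro: quotientI)
    ultimately show ?thesis by linarith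
  qed
  ultimately show ?thesis by blast
qed

text \<open>Induction on the number of vertices. If each vertex is missed by some maximum matching,
  the empty barrier works. Otherwise a vertex covered by all of them is deleted and then added to
  the barrier of the smaller graph.\<close>

theorem tutte_berge:
  assumes "simple_graph V E"
  shows "\<exists>M S \<Q>. matching E M \<and> odd_barrier V E S \<Q> \<and> card V + card S \<le> card \<Q> + 2 * card M"
  using assms
proof (induction "card V" arbitrary: V E)
  case 0
  then have "V = {}" by (simp add: simple_graph_def)
  then show ?case
    by (intro exI [of _ "{}"]) (simp add: matching_def odd_barrier_def)
next
  case (Suc n)
  obtain M where M: "maximum_matching E M" using ex_maximum_matching Suc by metis
  show ?case
  proof (cases "\<forall>v\<in>V. \<exists>N. maximum_matching E N \<and> v \<notin> \<Union>N")
    case True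
    then obtain \<Q> where "odd_barrier V E {} \<Q>" "card V \<le> card \<Q> + 2 * card M"
      using tutte_berge_missable [OF Suc.prems M] by blast
    then show ?thesis using M
      by (intro exI [of _ M] exI [of _ "{}"] exI [of _ \<Q>]) (simp add: maximum_matching_def)
  next
    case False
    then obtain v where v: "v \<in> V" "\<And>N. maximum_matching E N \<Longrightarrow> v \<in> \<Union>N" by blast
    have finV: "finite V" using Suc.prems by (simp add: simple_graph_def)
    let ?E = "{e \<in> E. v \<notin> e}"
    have "simple_graph (V - {v}) ?E" using Suc.prems by (auto simp: simple_graph_def)
    moreover have cV: "n = card (V - {v})" using Suc.hyps(2) v by simp
    ultimately obtain N S \<Q> where N: "matching ?E N" "odd_barrier (V - {v}) ?E S \<Q>"
        "card (V - {v}) + card S \<le> card \<Q> + 2 * card N"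
      using Suc.hyps(1) by blast
    have mN: "matching E N" "v \<notin> \<Union>N" using N(1) by (auto simp: matching_def)
    \<comment> \<open>\<open>N\<close> misses \<open>v\<close> and hence is not maximum. The
      resulting gain of at least 2 in \<open>2 * card M\<close> pays for \<open>v\<close> once in
      \<open>V\<close> and once in the barrier.\<close>
    have "card N \<le> card M" using M mN by (auto simp: maximum_matching_def)
    moreover have "card N \<noteq> card M"
      using v(2) [of N] mN M by (auto simp: maximum_matching_def)
    moreover have S: "S \<subseteq> V - {v}" using N(2) by (simp add: odd_barrier_def)
    then have "card (insert v S) = Suc (card S)" using finV by (meson Diff_iff card_insert_disjoint finite_Diff finite_subset insertI1 subset_iff)
    ultimately have "card V + card (insert v S) \<le> card \<Q> + 2 * card M"
      using N(3) cV Suc.hyps(2) by linarith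
    moreover have "odd_barrier V E (insert v S) \<Q>"
      unfolding odd_barrier_def
    proof (intro conjI ballI)
      fix Q e assume "Q \<in> \<Q>" "e \<in> E"
      then show "e \<subseteq> Q \<or> e \<inter> Q = {} \<or> e \<inter> insert v S \<noteq> {}"
        using N(2) by (cases "v \<in> e") (auto simp: odd_barrier_def)
    qed (use N(2) v(1) in \<open>auto simp: odd_barrier_def\<close>)
    ultimately show ?thesis using M unfolding maximum_matching_def by blast
  qed
qed

text \<open>The deficiency formula gives a surplus of at least 1, and parity raises it to 2. If the
  set \<open>T\<close> of leftover vertices has even order, then \<open>card S\<close> and
  \<open>card \<Q>\<close> have the same parity because \<open>card V\<close> is even; otherwise
  \<open>T\<close> is one more odd part.\<close>

corollary tutte_even:
  assumes G: "simple_graph V E" and "even (card V)" and "\<nexists>M. perfect_matching V E M"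
  shows "\<exists>S \<Q>. odd_barrier V E S \<Q> \<and> card S + 2 \<le> card \<Q>"
proof -
  obtain M S \<Q> where M: "matching E M" and S: "odd_barrier V E S \<Q>"
    and le: "card V + card S \<le> card \<Q> + 2 * card M"
    using tutte_berge [OF G] by blast
  have finV: "finite V" using G by (simp add: simple_graph_def)
  have sub: "\<Union>M \<subseteq> V" using M G by (auto simp: matching_def simple_graph_def)
  moreover have "\<Union>M \<noteq> V" using assms(3) M by (auto simp: perfect_matching_def)
  ultimately have "2 * card M < card V"
    using psubset_card_mono [OF finV, of "\<Union>M"] card_Union_matching [OF G M] by auto
  then have lt: "card S < card \<Q>" using le by linarith
  have fQ: "finite \<Q>"
    using S finV by (intro finite_subset [of \<Q> "Pow V"]) (auto simp: odd_barrier_def)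
  define T where "T = V - S - \<Union>\<Q>"
  show ?thesis
  proof (cases "even (card T)")
    case True
    have SV: "S \<subseteq> V" "\<Union>\<Q> \<subseteq> V - S" using S by (auto simp: odd_barrier_def)
    have "card V = card S + card (\<Union>\<Q>) + card T"
      using SV finV card_Diff_subset [of S V] card_Diff_subset [of "\<Union>\<Q>" "V - S"]
        card_mono [of "V - S" "\<Union>\<Q>"] card_mono [of V S]
      by (simp add: T_def finite_subset)
    moreover have "card (\<Union>\<Q>) = (\<Sum>Q\<in>\<Q>. card Q)"
      using S odd_pos card_ge_0_finite unfolding odd_barrier_def disjoint_def
      by (intro card_Union_disjoint) (fastforce simp: pairwise_def disjnt_def)+
    moreover have "even (\<Sum>Q\<in>\<Q>. card Q) \<longleftrightarrow> even (card \<Q>)"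
    proof -
      have "{Q \<in> \<Q>. odd (card Q)} = \<Q>" using S by (auto simp: odd_barrier_def)
      then show ?thesis using fQ by (simp add: even_sum_iff)
    qed
    ultimately have "even (card S) \<longleftrightarrow> even (card \<Q>)"
      using True assms(2) by auto
    then have "card \<Q> \<noteq> Suc (card S)" by auto
    then show ?thesis using S lt by (intro exI [of _ S] exI [of _ \<Q>]) auto
  next
    case False
    have "T \<noteq> {}" using False by auto
    then have "T \<notin> \<Q>" by (auto simp: T_def)
    then have "card S + 2 \<le> card (insert T \<Q>)" using lt fQ by simp
    moreover have "odd_barrier V E S (insert T \<Q>)"
    proof -
      have "e \<subseteq> T \<or> e \<inter> T = {} \<or> e \<inter> S \<noteq> {}" if "e \<in> E" for e
      proof -
        have "e \<subseteq> V" using that G by (auto simp: simple_graph_def)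
        moreover have "\<And>Q. Q \<in> \<Q> \<Longrightarrow> e \<subseteq> Q \<or> e \<inter> Q = {} \<or> e \<inter> S \<noteq> {}"
          using S that by (auto simp: odd_barrier_def)
        ultimately show ?thesis unfolding T_def by blast
      qed
      moreover have "disjoint (insert T \<Q>)"
        using S by (auto simp: odd_barrier_def disjoint_def T_def)
      moreover have "T \<subseteq> V - S" by (auto simp: T_def)
      ultimately show ?thesis using S False by (simp add: odd_barrier_def)
    qed
    ultimately show ?thesis by blast
  qed
qed

section \<open>Edge cuts in regular graphs\<close>

text \<open>Double counting of the incidences between \<open>X\<close> and the edges.\<close>

lemma regular_sum_card_Int:
  assumes G: "simple_graph V E" "regular r V E" and X: "X \<subseteq> V"
  shows "(\<Sum>e\<in>E. card (e \<inter> X)) = r * card X"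
proof -
  have fin: "finite X" "finite E"
    using G X simple_graph_finite by (auto simp: simple_graph_def intro: finite_subset)
  have "(\<Sum>e\<in>E. card (e \<inter> X)) = (\<Sum>e\<in>E. \<Sum>v\<in>X. if v \<in> e then 1 else 0)"
    using fin by (simp add: Int_commute flip: sum.inter_restrict)
  also have "\<dots> = (\<Sum>v\<in>X. \<Sum>e\<in>E. if v \<in> e then 1 else 0)"
    by (rule sum.swap)
  also have "\<dots> = (\<Sum>v\<in>X. degree E v)"
    using fin by (simp add: degree_def flip: sum.inter_filter)
  also have "\<dots> = r * card X"
    using G(2) X by (simp add: regular_def subset_iff)
  finally show ?thesis .
qed

definition boundary :: "'a set set \<Rightarrow> 'a set \<Rightarrow> 'a set set" where
  "boundary E X = {e \<in> E. card (e \<inter> X) = 1}"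

lemma edge_Int_cases:
  assumes "card e = 2"
  obtains "e \<inter> X = {}" | "card (e \<inter> X) = 1" "\<not> e \<subseteq> X" "e \<inter> X \<noteq> {}" | "e \<subseteq> X"
proof -
  obtain x y where "e = {x, y}" "x \<noteq> y" using assms by (auto simp: card_2_iff)
  then show ?thesis using that by (cases "x \<in> X"; cases "y \<in> X") auto
qed

lemma boundary_Compl:
  assumes "simple_graph V E"
  shows "boundary E (V - X) = boundary E X"
proof -
  have "card (e \<inter> (V - X)) = 1 \<longleftrightarrow> card (e \<inter> X) = 1" if e: "e \<in> E" for e
  proof -
    obtain x y where "e = {x, y}" "x \<noteq> y" "x \<in> V" "y \<in> V"
      using assms e by (auto simp: card_2_iff simple_graph_def)
    then show ?thesis by (cases "x \<in> X"; cases "y \<in> X") auto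
  qed
  then show ?thesis by (auto simp: boundary_def)
qed

text \<open>The degree sums over \<open>X\<close> and \<open>Y\<close> differ by at least
  \<open>r\<close>. Edges inside \<open>X \<union> Y\<close> contribute equally to both, so the
  difference comes from boundary edges, each contributing at most 1.\<close>

lemma boundary_bipartite:
  assumes G: "simple_graph V E" "regular r V E" and Q: "X \<union> Y \<subseteq> V"
    and bip: "\<And>e. e \<in> E \<Longrightarrow> e \<subseteq> X \<union> Y \<Longrightarrow> card (e \<inter> X) = 1 \<and> card (e \<inter> Y) = 1"
    and less: "card Y < card X"
  shows "r \<le> card (boundary E (X \<union> Y))"
proof -
  have finE: "finite E" using simple_graph_finite [OF G(1)] .
  have "card (e \<inter> X) \<le> card (e \<inter> Y) + (if e \<in> boundary E (X \<union> Y) then 1 else 0)"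
    if "e \<in> E" for e
  proof -
    have e: "card e = 2" "finite e" using G that by (auto simp: simple_graph_def intro: finite_subset)
    then show ?thesis
    proof (cases rule: edge_Int_cases [of e "X \<union> Y"])
      case 2
      then have "card (e \<inter> X) \<le> 1"
        using e card_mono [of "e \<inter> (X \<union> Y)" "e \<inter> X"] by auto
      then show ?thesis using 2 that by (simp add: boundary_def)
    qed (use bip [OF that] in \<open>auto simp: Int_Un_distrib\<close>)
  qed
  then have "(\<Sum>e\<in>E. card (e \<inter> X)) \<le>
      (\<Sum>e\<in>E. card (e \<inter> Y) + (if e \<in> boundary E (X \<union> Y) then 1 else 0))"
    by (rule sum_mono)
  also have "\<dots> = (\<Sum>e\<in>E. card (e \<inter> Y)) + card (boundary E (X \<union> Y))"
    using finE by (simp add: sum.distrib boundary_def flip: sum.inter_filter)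
  finally have "r * card X \<le> r * card Y + card (boundary E (X \<union> Y))"
    using regular_sum_card_Int [OF G] Q by simp
  moreover have "r * (card Y + 1) \<le> r * card X" using less by (intro mult_le_mono2) simp
  ultimately show ?thesis by simp
qed

text \<open>The degree sum over \<open>X\<close> counts boundary edges once and inner edges twice,
  and a forest on \<open>X\<close> has at most \<open>card X - 1\<close> edges. Terms are moved
  across to avoid subtraction.\<close>

lemma boundary_acyclic:
  assumes G: "simple_graph V E" "regular r V E" and X: "X \<subseteq> V" "X \<noteq> {}"
    and acyclic: "\<nexists>c. is_cycle X {e \<in> E. e \<subseteq> X} c"
  shows "r * card X + 2 \<le> card (boundary E X) + 2 * card X"
proof -
  have fin: "finite E" "finite X"
    using simple_graph_finite [OF G(1)] G X by (auto simp: simple_graph_def intro: finite_subset)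
  have "card (e \<inter> X) = (if e \<in> boundary E X then 1 else 0) + (if e \<subseteq> X then 2 else 0)"
    if "e \<in> E" for e
  proof -
    have e: "card e = 2" using G that by (auto simp: simple_graph_def)
    then show ?thesis
    proof (cases rule: edge_Int_cases [of e X])
      case 1
      moreover have "e \<noteq> {}" using e by auto
      ultimately have "\<not> e \<subseteq> X" by blast
      then show ?thesis using 1 by (simp add: boundary_def)
    next
      case 2
      then show ?thesis using that by (simp add: boundary_def)
    next
      case 3
      then show ?thesis using e by (simp add: boundary_def Int_absorb2)
    qed
  qed
  then have "r * card X = (\<Sum>e\<in>E. (if e \<in> boundary E X then 1 else 0) + (if e \<subseteq> X then 2 else 0))"
    using regular_sum_card_Int [OF G X(1)] by simp
  also have "\<dots> = card (boundary E X) + 2 * card {e \<in> E. e \<subseteq> X}"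
    using fin by (simp add: sum.distrib boundary_def flip: sum.inter_filter)
  finally have "r * card X = card (boundary E X) + 2 * card {e \<in> E. e \<subseteq> X}" .
  moreover have "card {e \<in> E. e \<subseteq> X} + 1 \<le> card X"
    using fin G X acyclic by (intro acyclic_card_edges) (auto simp: simple_graph_def)
  ultimately show ?thesis by linarith
qed

section \<open>Odd-cyclic edge cuts around vertex sets\<close>

lemma path_connected:
  "path_edges p \<subseteq> E \<Longrightarrow> v \<in> set p \<Longrightarrow> (hd p, v) \<in> {(x, y). {x, y} \<in> E}\<^sup>*"
proof (induction p rule: induct_list012)
  case (3 x y p)
  have "(x, y) \<in> {(x, y). {x, y} \<in> E}" using 3(3) by simp
  moreover have "(y, v) \<in> {(x, y). {x, y} \<in> E}\<^sup>*" if "v \<noteq> x"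
    using 3 that by simp
  ultimately show ?case by (auto intro: converse_rtrancl_into_rtrancl)
qed auto

text \<open>Removing the boundary keeps every edge inside \<open>X\<close>, hence the cycle, and the
  component of its first vertex cannot leave \<open>X\<close>.\<close>

lemma cycle_in_component:
  assumes G: "simple_graph V E" and "X \<subseteq> V" and c: "is_cycle X {e \<in> E. e \<subseteq> X} c"
  shows "\<exists>C\<in>components V (E - boundary E X). C \<subseteq> X \<and> C \<noteq> {} \<and> is_cycle C (E - boundary E X) c"
proof -
  let ?R = "{(x, y). {x, y} \<in> E - boundary E X}\<^sup>*"
  define C where "C = ?R `` {hd c}"
  have "e \<notin> boundary E X" if "e \<in> E" "e \<subseteq> X" for e
    using that G by (auto simp: boundary_def simple_graph_def Int_absorb2)
  then have edges: "cycle_edges c \<subseteq> E - boundary E X"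
    using c by (auto simp: is_cycle_def)
  have "c \<noteq> []" using c by (auto simp: is_cycle_def)
  then have hd: "hd c \<in> X" using c by (auto simp: is_cycle_def)
  have "y \<in> X" if "(hd c, y) \<in> ?R" for y
    using that
  proof (induction rule: rtrancl_induct)
    case (step y z)
    then have "{y, z} \<in> E" "card ({y, z} \<inter> X) \<noteq> 1" by (auto simp: boundary_def)
    then show ?case using step.IH by (cases "z \<in> X") auto
  qed (rule hd)
  then have "C \<subseteq> X" by (auto simp: C_def)
  moreover have "set c \<subseteq> C"
    using path_connected [of c "E - boundary E X"] edges by (auto simp: C_def cycle_edges_def)
  then have "is_cycle C (E - boundary E X) c" "C \<noteq> {}"
    using c edges \<open>c \<noteq> []\<close> by (auto simp: is_cycle_def)
  moreover have "C \<in> components V (E - boundary E X)"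
    using hd \<open>X \<subseteq> V\<close> by (auto simp: C_def components_def intro: quotientI)
  ultimately show ?thesis by blast
qed

lemma boundary_odd_cyclic_edge_cut:
  assumes G: "simple_graph V E" and X: "X \<subseteq> V"
    and c: "is_cycle X {e \<in> E. e \<subseteq> X} c" "odd (card (cycle_edges c))"
    and d: "is_cycle (V - X) {e \<in> E. e \<subseteq> V - X} d"
  shows "odd_cyclic_edge_cut V E (boundary E X)"
proof -
  let ?F = "boundary E X"
  obtain C where C: "C \<in> components V (E - ?F)" "C \<subseteq> X" "C \<noteq> {}" "is_cycle C (E - ?F) c"
    using cycle_in_component [OF G X c(1)] by blast
  obtain D where D: "D \<in> components V (E - ?F)" "D \<subseteq> V - X" "is_cycle D (E - ?F) d"
    using cycle_in_component [OF G _ d] boundary_Compl [OF G, of X] by auto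
  have "C \<noteq> D" using C D by blast
  moreover have "?F \<subseteq> E" by (auto simp: boundary_def)
  ultimately show ?thesis
    using C D c(2) unfolding odd_cyclic_edge_cut_def cyclic_edge_cut_def by blast
qed

lemma lambda_oc_le:
  "odd_cyclic_edge_cut V E F \<Longrightarrow> lambda_oc V E \<le> enat (card F)"
  unfolding lambda_oc_def by (rule INF_lower) simp

text \<open>If the complement of \<open>X\<close> is acyclic, it has so few edges that the bound holds anyway.\<close>

lemma boundary_odd_cycle:
  assumes G: "simple_graph V E" "regular r V E" and X: "X \<subseteq> V"
    and lambda: "lambda_oc V E \<ge> enat ((2 * m - 1) * (r - 1))"
    and m: "2 \<le> m" "m \<le> r - 1" and large: "2 * m + 1 \<le> card (V - X)"
    and c: "is_cycle X {e \<in> E. e \<subseteq> X} c" "odd (card (cycle_edges c))"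
  shows "(2 * m - 1) * (r - 1) \<le> card (boundary E X)"
proof (cases "\<exists>d. is_cycle (V - X) {e \<in> E. e \<subseteq> V - X} d")
  case True
  then have "odd_cyclic_edge_cut V E (boundary E X)"
    using boundary_odd_cyclic_edge_cut [OF G(1) X c] by blast
  then have "enat ((2 * m - 1) * (r - 1)) \<le> enat (card (boundary E X))"
    using lambda lambda_oc_le order_trans by blast
  then show ?thesis by simp
next
  case False
  have "V - X \<noteq> {}"
  proof
    assume "V - X = {}"
    then have "card (V - X) = 0" by (simp only: card.empty)
    then show False using large by linarith
  qed
  then have "r * card (V - X) + 2 \<le> card (boundary E X) + 2 * card (V - X)"
    using boundary_acyclic [OF G, of "V - X"] False boundary_Compl [OF G(1), of X] by auto
  moreover obtain t where t: "r = t + 2" using m that [of "r - 2"] by simp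
  ultimately have "t * card (V - X) + 2 \<le> card (boundary E X)"
    by (simp add: algebra_simps)
  moreover have "t * (2 * m + 1) \<le> t * card (V - X)"
    using large by (rule mult_le_mono2)
  \<comment> \<open>With \<open>r = t + 2\<close> the right side exceeds the left by
    \<open>2 * t + 3 - 2 * m\<close>, which is positive because
    \<open>m \<le> t + 1\<close>.\<close>
  moreover have "(2 * m - 1) * (r - 1) \<le> t * (2 * m + 1) + 2"
  proof -
    obtain k where "m = Suc k" using m by (cases m) auto
    then show ?thesis using m t by (simp add: algebra_simps)
  qed
  ultimately show ?thesis by linarith
qed

section \<open>The independent set obtained from a barrier\<close>

text \<open>The larger colour class of each part makes up at least half of it, and strictly more in
  an odd part. So \<open>2 * card W\<close> exceeds the total order of the parts by at least
  \<open>card S + 2\<close>, which makes up for the vertices of \<open>S\<close> and leaves the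
  extra 2.\<close>

lemma ex_large_independent_set:
  assumes G: "simple_graph V E" "regular r V E" and even: "even (card V)"
    and lambda: "lambda_oc V E \<ge> enat ((2 * m - 1) * (r - 1))"
    and m: "2 \<le> m" "m \<le> r - 1"
    and M: "matching E M" "card M = m"
    and none: "\<nexists>N. perfect_matching (V - \<Union>M) {e \<in> E. e \<subseteq> V - \<Union>M} N"
  shows "\<exists>W. W \<subseteq> V - \<Union>M \<and> (\<forall>e\<in>E. card (e \<inter> W) \<le> 1) \<and> card V + 2 \<le> 2 * card W + 2 * m"
proof -
  define U where "U = \<Union>M"
  define H where "H = {e \<in> E. e \<subseteq> V - U}"
  have finV: "finite V" and finE: "finite E"
    using G simple_graph_finite by (auto simp: simple_graph_def)
  have edge: "card e = 2" "e \<subseteq> V" "finite e" if "e \<in> E" for e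
    using G that finV by (auto simp: simple_graph_def intro: finite_subset)
  have U: "U \<subseteq> V" "card U = 2 * m"
    using card_Union_matching [OF G(1) M(1)] M edge by (auto simp: U_def matching_def)
  have finU: "finite U" using U finV finite_subset by blast
  have cVU: "card (V - U) + 2 * m = card V"
    using U finV finU card_mono [OF finV U(1)] by (simp add: card_Diff_subset)
  have "simple_graph (V - U) H" using G by (auto simp: H_def simple_graph_def)
  moreover have "even (card (V - U))" using cVU even by (metis dvd_triv_left even_add)
  ultimately obtain S \<Q> where barrier: "odd_barrier (V - U) H S \<Q>" and large: "card S + 2 \<le> card \<Q>"
    using tutte_even none unfolding U_def H_def by blast
  have S: "S \<subseteq> V - U" and disjQ: "disjoint \<Q>"
    and Q: "\<And>Q. Q \<in> \<Q> \<Longrightarrow> Q \<subseteq> V - U - S" "\<And>Q. Q \<in> \<Q> \<Longrightarrow> odd (card Q)"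
    using barrier by (auto simp: odd_barrier_def)
  have Q_edge: "e \<subseteq> Q \<or> e \<inter> Q = {} \<or> e \<inter> (U \<union> S) \<noteq> {}" if "Q \<in> \<Q>" "e \<in> E" for Q e
  proof (cases "e \<inter> U = {}")
    case True
    then have "e \<in> H" using that edge by (auto simp: H_def)
    then have "e \<subseteq> Q \<or> e \<inter> Q = {} \<or> e \<inter> S \<noteq> {}"
      using barrier that by (simp add: odd_barrier_def)
    then show ?thesis by blast
  qed blast
  have finS: "finite S" using S finV finite_subset by blast
  have finQ: "finite \<Q>"
    using Q(1) finV by (intro finite_subset [of \<Q> "Pow V"]) auto
  \<comment> \<open>\<open>T\<close> collects the vertices in no odd part; it may be empty or of any
    order. Together with \<open>\<Q>\<close> it exhausts the vertices outside \<open>U\<close> and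
    \<open>S\<close>.\<close>
  define T where "T = V - U - S - \<Union>\<Q>"
  define \<P> where "\<P> = insert T \<Q>"
  have "T \<notin> \<Q>"
  proof
    assume "T \<in> \<Q>"
    then have "T = {}" by (auto simp: T_def)
    then show False using Q(2) [OF \<open>T \<in> \<Q>\<close>] by simp
  qed
  have finP: "finite \<P>" using finQ by (simp add: \<P>_def)
  have P: "P \<subseteq> V - U - S" if "P \<in> \<P>" for P
    using that Q by (auto simp: \<P>_def T_def)
  have finP': "finite P" if "P \<in> \<P>" for P
    using P [OF that] finV by (meson Diff_subset finite_subset subset_trans)
  have disjP: "P = P'" if "P \<in> \<P>" "P' \<in> \<P>" "x \<in> P" "x \<in> P'" for P P' x
    using that disjQ by (auto simp: \<P>_def T_def disjoint_def)
  have UP: "\<Union>\<P> = V - U - S" using Q by (auto simp: \<P>_def T_def)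
  have P_edge: "e \<subseteq> P \<or> e \<inter> P = {} \<or> e \<inter> (U \<union> S) \<noteq> {}" if "P \<in> \<P>" "e \<in> E" for P e
  proof (cases "P = T")
    case True
    show ?thesis
    proof (cases "\<exists>Q\<in>\<Q>. e \<inter> Q \<noteq> {}")
      case True
      then show ?thesis
        using Q_edge [OF _ that(2)] unfolding \<open>P = T\<close> T_def by blast
    next
      case False
      then show ?thesis
        using edge(2) [OF that(2)] unfolding \<open>P = T\<close> T_def by blast
    qed
  next
    case False
    then show ?thesis using that Q_edge by (auto simp: \<P>_def)
  qed

  define D where "D = boundary E (U \<union> S)"
  \<comment> \<open>The \<open>m\<close> edges of \<open>M\<close> lie inside
    \<open>U \<union> S\<close> and use up \<open>2 * m\<close> of its degree sum.\<close>
  have D: "card D + 2 * m \<le> r * (2 * m + card S)"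
  proof -
    have sub: "M \<subseteq> E" using M by (simp add: matching_def)
    then have finM: "finite M" using finE finite_subset by blast
    have M2: "card (e \<inter> (U \<union> S)) = 2" if "e \<in> M" for e
    proof -
      have "e \<inter> (U \<union> S) = e" using that by (auto simp: U_def)
      then show ?thesis using edge that sub by auto
    qed
    then have "M \<inter> D = {}" by (auto simp: D_def boundary_def)
    then have "card D + 2 * m = (\<Sum>e\<in>D \<union> M. card (e \<inter> (U \<union> S)))"
      using M2 M finM finE by (subst sum.union_disjoint) (auto simp: D_def boundary_def)
    also have "\<dots> \<le> (\<Sum>e\<in>E. card (e \<inter> (U \<union> S)))"
      using finE sub by (intro sum_mono2) (auto simp: D_def boundary_def)
    also have "\<dots> = r * card (U \<union> S)"
      using U S by (intro regular_sum_card_Int [OF G]) auto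
    also have "card (U \<union> S) = 2 * m + card S"
      using U S finU finS by (subst card_Un_disjoint) auto
    finally show ?thesis .
  qed
  \<comment> \<open>An edge leaving a part has its other end in \<open>U \<union> S\<close>, so it
    belongs to \<open>D\<close> and to the boundary of no other part. Hence the boundaries of the
    parts have total size at most \<open>card D\<close>.\<close>
  have bound_D: "boundary E P \<subseteq> D" if "P \<in> \<P>" for P
  proof
    fix e assume "e \<in> boundary E P"
    then have e: "e \<in> E" "card (e \<inter> P) = 1" by (auto simp: boundary_def)
    obtain x y where xy: "e = {x, y}" "x \<noteq> y" using edge(1) [OF e(1)] by (auto simp: card_2_iff)
    have "x \<in> P \<longleftrightarrow> y \<notin> P" using e xy by (simp add: card_doubleton_Int)
    moreover from this have "{x, y} \<inter> (U \<union> S) \<noteq> {}"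
      using P_edge [OF that e(1)] xy by blast
    ultimately have "x \<in> U \<union> S \<longleftrightarrow> y \<notin> U \<union> S" using P [OF that] by blast
    then show "e \<in> D"
      unfolding D_def boundary_def using e(1) xy by (simp add: card_doubleton_Int)
  qed
  have bound_disj: "boundary E P \<inter> boundary E P' = {}" if "P \<in> \<P>" "P' \<in> \<P>" "P \<noteq> P'" for P P'
  proof (rule ccontr)
    assume "boundary E P \<inter> boundary E P' \<noteq> {}"
    then obtain e where e: "e \<in> boundary E P" "e \<in> boundary E P'" by blast
    then obtain x y where xy: "e = {x, y}" "x \<noteq> y" using edge(1) [of e] by (auto simp: card_2_iff boundary_def)
    have "e \<in> D" using bound_D that e by blast
    moreover have "P \<inter> P' = {}" using disjP that by blast
    moreover have "x \<in> P \<longleftrightarrow> y \<notin> P" "x \<in> P' \<longleftrightarrow> y \<notin> P'"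
      using e xy by (simp_all add: boundary_def card_doubleton_Int)
    ultimately have "e \<inter> (U \<union> S) = {}"
      using xy P [OF that(1)] P [OF that(2)] by blast
    then show False using \<open>e \<in> D\<close> by (simp add: D_def boundary_def)
  qed
  have bound_sum: "(\<Sum>P\<in>\<R>. card (boundary E P)) \<le> card D" if "\<R> \<subseteq> \<P>" for \<R>
  proof -
    have "finite \<R>" "\<And>P. finite (boundary E P)"
      using that finP finE finite_subset by (auto simp: boundary_def)
    then have "(\<Sum>P\<in>\<R>. card (boundary E P)) = card (\<Union>P\<in>\<R>. boundary E P)"
      using that bound_disj by (intro card_UN_disjoint [symmetric]) (simp_all add: subset_iff)
    also have "\<dots> \<le> card D"
      using that bound_D finE by (intro card_mono) (auto simp: D_def boundary_def)
    finally show ?thesis .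
  qed

  have dichotomy: "(\<exists>A. \<forall>e\<in>E. e \<subseteq> P \<longrightarrow> card (e \<inter> A) = 1) \<or>
      (2 * m - 1) * (r - 1) \<le> card (boundary E P)" if "P \<in> \<P>" for P
  proof (cases "\<exists>A. \<forall>e\<in>{e \<in> E. e \<subseteq> P}. card (e \<inter> A) = 1")
    case False
    moreover have "(\<exists>A. \<forall>e\<in>{e \<in> E. e \<subseteq> P}. card (e \<inter> A) = 1) \<or>
        (\<exists>c. is_cycle P {e \<in> E. e \<subseteq> P} c \<and> odd (card (cycle_edges c)))"
      using finE edge(1) by (intro bipartite_or_odd_cycle) simp_all
    ultimately obtain c where c: "is_cycle P {e \<in> E. e \<subseteq> P} c" "odd (card (cycle_edges c))"
      by blast
    \<comment> \<open>\<open>U\<close> and a vertex of another odd part supply the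
      \<open>2 * m + 1\<close> vertices outside \<open>P\<close> that the bound for odd cycles
      requires.\<close>
    have "\<not> \<Q> \<subseteq> {P}" using large card_mono [of "{P}" \<Q>] by auto
    then obtain Q' where Q': "Q' \<in> \<Q>" "Q' \<noteq> P" by blast
    then have "Q' \<noteq> {}" using Q(2) by force
    then obtain x where x: "x \<in> Q'" by blast
    have "x \<notin> P" "x \<in> V - U"
      using disjP [of Q' P x] Q' x that Q(1) [OF Q'(1)] by (auto simp: \<P>_def)
    then have "insert x U \<subseteq> V - P" using U P [OF that] by auto
    then have "card (insert x U) \<le> card (V - P)" using finV by (intro card_mono) auto
    then have "2 * m + 1 \<le> card (V - P)" using U finU \<open>x \<in> V - U\<close> by simp
    then show ?thesis
      using boundary_odd_cycle [OF G _ lambda m _ c] P [OF that] by blast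
  qed auto
  have bip_half: "\<exists>A. A \<subseteq> P \<and> (\<forall>e\<in>E. e \<subseteq> P \<longrightarrow> card (e \<inter> A) = 1 \<and> card (e \<inter> (P - A)) = 1) \<and>
      card (P - A) \<le> card A"
    if P': "P \<in> \<P>" and A: "\<And>e. e \<in> E \<Longrightarrow> e \<subseteq> P \<Longrightarrow> card (e \<inter> A) = 1" for P A
  proof -
    have split: "card (e \<inter> (P \<inter> A)) = 1 \<and> card (e \<inter> (P - A)) = 1" if e: "e \<in> E" "e \<subseteq> P" for e
    proof -
      obtain x y where "e = {x, y}" "x \<noteq> y" using edge(1) [OF e(1)] by (auto simp: card_2_iff)
      then show ?thesis using A [OF e] e by (cases "x \<in> A"; cases "y \<in> A") auto
    qed
    have "P - (P \<inter> A) = P - A" "P - (P - A) = P \<inter> A" by auto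
    then show ?thesis
      using split
      by (cases "card (P - A) \<le> card (P \<inter> A)")
        (rule exI [of _ "P \<inter> A"], simp, rule exI [of _ "P - A"], auto)
  qed
  \<comment> \<open>Odd order makes the colour classes differ in size, and this surplus forces
    \<open>r\<close> boundary edges. In the non-bipartite case \<open>3 * (r - 1) \<ge> r\<close>
    suffices.\<close>
  have bound_Q: "r \<le> card (boundary E Q)" if "Q \<in> \<Q>" for Q
  proof -
    have QP: "Q \<in> \<P>" using that by (simp add: \<P>_def)
    consider A where "\<And>e. e \<in> E \<Longrightarrow> e \<subseteq> Q \<Longrightarrow> card (e \<inter> A) = 1"
      | "(2 * m - 1) * (r - 1) \<le> card (boundary E Q)"
      using dichotomy [OF QP] by blast
    then show ?thesis
    proof cases
      case 1
      obtain A where A: "A \<subseteq> Q" "card (Q - A) \<le> card A"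
          "\<And>e. e \<in> E \<Longrightarrow> e \<subseteq> Q \<Longrightarrow> card (e \<inter> A) = 1 \<and> card (e \<inter> (Q - A)) = 1"
        using bip_half [OF QP 1] by blast
      have "card Q = card A + card (Q - A)"
        using A(1) finP' [OF QP] by (metis card_Diff_subset card_mono finite_subset le_add_diff_inverse)
      then have "card (Q - A) < card A" using Q(2) [OF that] A(2) by (cases "card (Q - A) = card A") auto
      moreover have "A \<union> (Q - A) = Q" using A(1) by auto
      ultimately show ?thesis
        using boundary_bipartite [OF G, of A "Q - A"] A(3) Q(1) [OF that] by auto
    next
      case 2
      have "3 * (r - 1) \<le> (2 * m - 1) * (r - 1)" using m by (intro mult_le_mono1) simp
      then show ?thesis using 2 m by linarith
    qed
  qed
  have bip: "\<exists>A. \<forall>e\<in>E. e \<subseteq> P \<longrightarrow> card (e \<inter> A) = 1" if "P \<in> \<P>" for P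
  proof (rule ccontr)
    assume "\<not> ?thesis"
    then have 1: "(2 * m - 1) * (r - 1) \<le> card (boundary E P)" using dichotomy [OF that] by blast
    \<comment> \<open>At least \<open>card S + 1\<close> odd parts other than \<open>P\<close> send
      out \<open>r\<close> edges each. Together with those of \<open>P\<close> this makes at least
      \<open>2 * m * (r - 1) + r * card S + 1\<close> edges, one more than \<open>D\<close> can
      contain.\<close>
    let ?R = "\<Q> - {P}"
    have "card S + 1 \<le> card ?R" using large diff_card_le_card_Diff [of "{P}" \<Q>] by simp
    then have "(card S + 1) * r \<le> card ?R * r" by (rule mult_le_mono1)
    also have "card ?R * r \<le> (\<Sum>Q\<in>?R. card (boundary E Q))"
      using sum_mono [of ?R "\<lambda>_. r" "\<lambda>Q. card (boundary E Q)"] bound_Q by simp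
    finally have "(2 * m - 1) * (r - 1) + (card S + 1) * r \<le> (\<Sum>Q\<in>insert P ?R. card (boundary E Q))"
      using 1 finQ sum.insert [of ?R P "\<lambda>Q. card (boundary E Q)"]
      by (simp del: insert_Diff_single)
    also have "\<dots> \<le> card D" using that by (intro bound_sum) (auto simp: \<P>_def)
    finally have "(2 * m - 1) * (r - 1) + (card S + 1) * r + 2 * m \<le> r * (2 * m + card S)"
      using D by linarith
    moreover obtain k t where "m = Suc k" "r = Suc t" using m by (cases m; cases r) auto
    ultimately show False by (simp add: algebra_simps)
  qed
  have "\<forall>P\<in>\<P>. \<exists>A. A \<subseteq> P \<and> (\<forall>e\<in>E. e \<subseteq> P \<longrightarrow> card (e \<inter> A) = 1) \<and> card (P - A) \<le> card A"
    using bip bip_half by meson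
  then obtain A where A: "\<And>P. P \<in> \<P> \<Longrightarrow> A P \<subseteq> P" "\<And>P. P \<in> \<P> \<Longrightarrow> card (P - A P) \<le> card (A P)"
      "\<And>P e. P \<in> \<P> \<Longrightarrow> e \<in> E \<Longrightarrow> e \<subseteq> P \<Longrightarrow> card (e \<inter> A P) = 1"
    by metis
  define W where "W = (\<Union>P\<in>\<P>. A P)"
  have cardA: "card P \<le> 2 * card (A P)" if "P \<in> \<P>" for P
    using A(1,2) [OF that] finP' [OF that] by (simp add: card_Diff_subset finite_subset)
  have "card W = (\<Sum>P\<in>\<P>. card (A P))"
    unfolding W_def using finP finP' A(1) disjP
    by (intro card_UN_disjoint) (blast intro: finite_subset)+
  then have "2 * card W = 2 * card (A T) + (\<Sum>Q\<in>\<Q>. 2 * card (A Q))"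
    using finQ \<open>T \<notin> \<Q>\<close> by (simp add: \<P>_def sum_distrib_left)
  moreover have "card T \<le> 2 * card (A T)" using cardA by (simp add: \<P>_def)
  moreover have "card Q + 1 \<le> 2 * card (A Q)" if "Q \<in> \<Q>" for Q
  proof -
    have "card Q \<noteq> 2 * card (A Q)" using Q(2) [OF that] by auto
    then show ?thesis using cardA [of Q] that by (simp add: \<P>_def)
  qed
  then have "(\<Sum>Q\<in>\<Q>. card Q + 1) \<le> (\<Sum>Q\<in>\<Q>. 2 * card (A Q))" by (rule sum_mono)
  moreover have "card (V - U - S) = card T + (\<Sum>Q\<in>\<Q>. card Q)"
  proof -
    have "card (V - U - S) = (\<Sum>P\<in>\<P>. card P)"
      unfolding UP [symmetric] using finP' disjP
      by (intro card_Union_disjoint) (auto simp: pairwise_def disjnt_def)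
    then show ?thesis using finQ \<open>T \<notin> \<Q>\<close> by (simp add: \<P>_def)
  qed
  moreover have "card (V - U) = card (V - U - S) + card S"
    using S finS finV card_mono [of "V - U" S] by (simp add: card_Diff_subset)
  ultimately have "card V + 2 \<le> 2 * card W + 2 * m"
    using large cVU by (simp add: sum_Suc)
  moreover have "W \<subseteq> V - U" using A(1) P by (auto simp: W_def)
  \<comment> \<open>An edge inside \<open>W\<close> would avoid \<open>U \<union> S\<close> and
    hence lie within a single part, but there the chosen colour class contains only one of its
    ends.\<close>
  moreover have "card (e \<inter> W) \<le> 1" if e: "e \<in> E" for e
  proof (cases rule: edge_Int_cases [OF edge(1) [OF e], of W])
    case 3
    then have "e \<inter> (U \<union> S) = {}" using A(1) P unfolding W_def by fastforce
    moreover have "e \<noteq> {}" using edge(1) [OF e] by auto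
    then obtain x P where x: "x \<in> e" "P \<in> \<P>" "x \<in> A P"
      using 3 unfolding W_def by blast
    ultimately have "e \<subseteq> P" using P_edge [OF x(2) e] A(1) by blast
    then have "e \<inter> W \<subseteq> e \<inter> A P" using A(1) disjP x(2) unfolding W_def by blast
    then have "card (e \<inter> W) \<le> card (e \<inter> A P)" using edge(3) [OF e] by (intro card_mono) auto
    then show ?thesis using A(3) [OF x(2) e \<open>e \<subseteq> P\<close>] by simp
  qed auto
  ultimately show ?thesis unfolding U_def by blast
qed

section \<open>Odd ears\<close>

text \<open>If all edges of an ear meet \<open>W\<close>, then its vertices alternate between
  \<open>W\<close> and the complement. A path with both ends in \<open>U\<close>, thus outside
  \<open>W\<close>, then has an even number of edges; on a cycle the closing edge alternates too, so
  its length is even.\<close>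

lemma odd_ear_meets_uncovered:
  assumes G: "simple_graph V E" and W: "W \<inter> U = {}" "\<And>e. e \<in> E \<Longrightarrow> card (e \<inter> W) \<le> 1"
    and P: "odd_ear V E U P"
  shows "P \<inter> {e \<in> E. e \<inter> W = {}} \<noteq> {}"
proof
  assume *: "P \<inter> {e \<in> E. e \<inter> W = {}} = {}"
  have alt: "x \<in> W \<longleftrightarrow> y \<notin> W" if "{x, y} \<in> P" "P \<subseteq> E" for x y
  proof -
    have e: "{x, y} \<in> E" using that by blast
    have "x \<noteq> y" using G e by (force simp: simple_graph_def)
    moreover have "{x, y} \<inter> W \<noteq> {}" using * that e by blast
    ultimately show ?thesis using W(2) [OF e] by (cases "x \<in> W"; cases "y \<in> W") auto
  qed
  from P consider p where "is_path V E p" "hd p \<in> U" "last p \<in> U" "P = path_edges p"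
    | c where "is_cycle V E c" "P = cycle_edges c"
    unfolding odd_ear_def is_ear_def by blast
  then have "even (card P)"
  proof cases
    case 1
    then have "odd (length p)"
      using path_edges_alternating [of p W] alt W(1) by (auto simp: is_path_def)
    then show ?thesis using 1 by (simp add: card_path_edges is_path_def)
  next
    case 2
    then have c: "c \<noteq> []" "path_edges c \<subseteq> P" "{last c, hd c} \<in> P" "P \<subseteq> E"
      by (auto simp: is_cycle_def cycle_edges_def)
    then have "(hd c \<in> W \<longleftrightarrow> last c \<in> W) \<longleftrightarrow> odd (length c)"
      using alt by (intro path_edges_alternating) auto
    then have "even (length c)" using alt [of "last c" "hd c"] c by blast
    then show ?thesis using 2 by (simp add: card_cycle_edges is_cycle_def)
  qed
  then show False using P by (simp add: odd_ear_def)
qed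

text \<open>Choosing an element of \<open>F\<close> from each member is injective by
  disjointness.\<close>

lemma card_disjoint_le:
  assumes "disjoint \<P>" "finite F" "\<And>P. P \<in> \<P> \<Longrightarrow> P \<inter> F \<noteq> {}"
  shows "card \<P> \<le> card F"
proof -
  obtain f where f: "\<And>P. P \<in> \<P> \<Longrightarrow> f P \<in> P \<inter> F"
    using bchoice [of \<P> "\<lambda>P x. x \<in> P \<inter> F"] assms(3) by blast
  have "inj_on f \<P>"
    using f assms(1) by (auto simp: inj_on_def disjoint_def) (metis IntI empty_iff)+
  then show ?thesis using f assms(2) by (intro card_inj_on_le) auto
qed

section \<open>Comparing the odd ears with the edges that avoid the independent set\<close>

theorem theorem7:
  fixes V :: "'a set" and E M :: "'a set set" and m r :: nat
  assumes "2 \<le> m" and "m \<le> r - 1"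
    and "simple_graph V E" and "regular r V E" and "even (card V)"
    and "lambda_oc V E \<ge> enat ((2 * m - 1) * (r - 1))"
    and "matching E M" and "card M = m"
    and "has_disjoint_odd_ears V E (\<Union>M) (m * r - r + 1)"
  shows "\<exists>M'. perfect_matching V E M' \<and> M \<subseteq> M'"
proof (cases "\<exists>N. perfect_matching (V - \<Union>M) {e \<in> E. e \<subseteq> V - \<Union>M} N")
  case True
  then obtain N where N: "N \<subseteq> E" "disjoint N" "\<Union>N = V - \<Union>M"
    by (auto simp: perfect_matching_def matching_def)
  have M: "M \<subseteq> E" "disjoint M" using assms(7) by (auto simp: matching_def)
  have "\<Union>(M \<union> N) = V"
    using N M assms(3) by (auto simp: simple_graph_def)
  moreover have "disjoint (M \<union> N)"
    using N M by (intro disjoint_union) auto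
  ultimately have "perfect_matching V E (M \<union> N)"
    using M N by (simp add: perfect_matching_def matching_def)
  then show ?thesis by blast
next
  case False
  obtain W where W: "W \<subseteq> V - \<Union>M" "\<And>e. e \<in> E \<Longrightarrow> card (e \<inter> W) \<le> 1"
      "card V + 2 \<le> 2 * card W + 2 * m"
    using ex_large_independent_set [OF assms(3-6,1,2,7,8) False] by blast
  define F where "F = {e \<in> E. e \<inter> W = {}}"
  have finE: "finite E" using simple_graph_finite assms(3) by blast
  have edge: "card e = 2" "e \<inter> V = e" "finite e" if "e \<in> E" for e
    using assms(3) that by (auto simp: simple_graph_def intro: finite_subset)
  \<comment> \<open>Every edge either belongs to \<open>F\<close> or meets \<open>W\<close> in
    exactly one vertex.\<close>
  have "card E = (\<Sum>e\<in>E. (if e \<inter> W = {} then 1 else 0) + card (e \<inter> W))"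
  proof -
    have "(if e \<inter> W = {} then 1 else 0) + card (e \<inter> W) = 1" if "e \<in> E" for e
      using W(2) [OF that] edge(3) [OF that] by (auto simp: le_Suc_eq)
    then show ?thesis by simp
  qed
  also have "\<dots> = card F + r * card W"
    using regular_sum_card_Int [OF assms(3,4), of W] W(1) finE
    by (auto simp: sum.distrib F_def simp flip: sum.inter_filter)
  finally have "card E = card F + r * card W" .
  moreover have "2 * card E = r * card V"
    using regular_sum_card_Int [OF assms(3,4), of V] edge by simp
  moreover have "r * (card V + 2) \<le> r * (2 * card W + 2 * m)"
    using W(3) by (rule mult_le_mono2)
  \<comment> \<open>Doubling the edge count and cancelling \<open>2 * r * card W\<close> leaves
    \<open>2 * card F + 2 * r \<le> 2 * m * r\<close>. So \<open>F\<close> has fewer edges than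
    there are ears, though the disjoint ears each need one of its edges.\<close>
  ultimately have "card F + r \<le> m * r" by (simp add: algebra_simps)
  moreover obtain \<P> where P: "card \<P> = m * r - r + 1" "disjoint \<P>"
      "\<And>P. P \<in> \<P> \<Longrightarrow> odd_ear V E (\<Union>M) P"
    using assms(9) by (auto simp: has_disjoint_odd_ears_def)
  have "P \<inter> F \<noteq> {}" if "P \<in> \<P>" for P
    using odd_ear_meets_uncovered [OF assms(3) _ W(2) P(3)] W(1) that unfolding F_def by blast
  then have "card \<P> \<le> card F"
    using P(2) finE by (intro card_disjoint_le) (auto simp: F_def)
  ultimately show ?thesis using P(1) by linarith
qed

end
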